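(* Let $D$ be a domain in $\mathbb{C}^n$, let $\mathcal{F}$ be a family of holomorphic functions on $D$, and let $k$ be a positive integer. If for every $f\in\mathcal{F}$, every $z\in D$ and every $v=(v_1,\dots,v_n)\in\mathbb{C}^n$ with $\|v\|=1$ we have $f(z)\neq 0$ and $(D^kf(z),v)\neq 1$, then $\mathcal{F}$ is normal in $D$.
   Context: $D^k$ denotes the operator $\left(\frac{\partial^k}{\partial z_1^k},\dots,\frac{\partial^k}{\partial z_n^k}\right)$, and $(D^kf(z),v)=\sum_{j=1}^n \frac{\partial^k f}{\partial z_j^k}(z)\,v_j$. $\|\cdot\|$ is the Euclidean norm. A family of holomorphic functions on $D$ is normal in $D$ if every sequence in it has a subsequence converging locally uniformly in $D$.
   Formalization: "Normal" here means every sequence in the family has a subsequence that converges locally uniformly in D or diverges locally uniformly to infinity; with convergence to finite limits only, the family of constants 1, 2, 3, ... is a counterexample. *)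

theory Defs
  imports "HOL-Analysis.Analysis"
begin

definition holomorphic_on_n :: "(complex ^ 'n \<Rightarrow> complex) \<Rightarrow> (complex ^ 'n) set \<Rightarrow> bool" where
  "holomorphic_on_n f D \<longleftrightarrow>
     (\<forall>z\<in>D. \<exists>L. (f has_derivative L) (at z) \<and> (\<forall>c x. L (c *s x) = c * L x))"

definition partial_k :: "nat \<Rightarrow> 'n \<Rightarrow> (complex ^ 'n \<Rightarrow> complex) \<Rightarrow> complex ^ 'n \<Rightarrow> complex" where
  "partial_k k j f z = (deriv ^^ k) (\<lambda>t. f (z + axis j t)) 0"

definition Dk_pair :: "nat \<Rightarrow> (complex ^ 'n \<Rightarrow> complex) \<Rightarrow> complex ^ 'n \<Rightarrow> complex ^ 'n \<Rightarrow> complex" where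
  "Dk_pair k f z v = (\<Sum>j\<in>UNIV. partial_k k j f z * v $ j)"

definition normal_family_on :: "(complex ^ 'n \<Rightarrow> complex) set \<Rightarrow> (complex ^ 'n) set \<Rightarrow> bool" where
  "normal_family_on F D \<longleftrightarrow>
    (\<forall>s::nat \<Rightarrow> (complex ^ 'n \<Rightarrow> complex). range s \<subseteq> F \<longrightarrow>
      (\<exists>r. strict_mono r \<and>
        ((\<exists>g. \<forall>z\<in>D. \<exists>U. open U \<and> z \<in> U \<and> U \<subseteq> D \<and>
                 uniform_limit U (\<lambda>m. s (r m)) g sequentially)
         \<or> (\<forall>z\<in>D. \<exists>U. open U \<and> z \<in> U \<and> U \<subseteq> D \<and>
                 (\<forall>M. eventually (\<lambda>m. \<forall>w\<in>U. norm (s (r m) w) > M) sequentially)))))"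

end

theory Submission
  imports Defs "HOL-Complex_Analysis.Complex_Analysis"
begin

text \<open>
  Taking v to be a multiple of a basis vector, the hypothesis forces every pure k-th derivative
  of f to have modulus different from 1; nothing else is used.

  In one variable, let f be zero-free on a disc with |f^(k)| different from 1 there. By
  connectedness |f^(k)| is either below 1, or above 1, and then it is controlled by its value at
  the centre (Harnack for the positive harmonic function ln |f^(k)|). Taylor's formula therefore
  bounds |f| by C1 S^3, where S collects the derivatives of order at most k at the centre.
  Conversely, f = exp u with Re u bounded above, so Borel-Caratheodory bounds S by a constant
  times |f(0)| (1 + ln (C1 S^3 / |f(0)|))^k. As the logarithm grows slowly, S, and hence f near
  the centre, is bounded in terms of |f(0)| alone.

  Moving one coordinate at a time gives the same on polydiscs. On a connected domain, a sequence
  then either tends to infinity at every point, hence locally uniformly, or has a subsequence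
  that is locally bounded, to which Arzela-Ascoli applies.
\<close>

section \<open>Zero-free functions on a disc\<close>

text \<open>Schwarz's lemma, transported from the half-plane \<open>Re u < L\<close> to the unit
  disc. It is applied below to differences of holomorphic logarithms, which vanish at the
  centre.\<close>

lemma borel_caratheodory:
  assumes holh: "h holomorphic_on ball 0 R" and "h 0 = 0"
    and re: "\<And>z. norm z < R \<Longrightarrow> Re (h z) < L" and z: "norm z < R"
  shows "(R - norm z) * norm (h z) \<le> 2 * L * norm z"
proof -
  have R: "0 < R" using z norm_ge_zero[of z] by linarith
  have L: "0 < L" using re[of 0] R \<open>h 0 = 0\<close> by simp
  \<comment> \<open>\<open>u / (2 L - u)\<close> maps the half-plane \<open>Re u < L\<close> into the unit disc.\<close>
  define \<phi> where "\<phi> = (\<lambda>w. h (of_real R * w) / (2 * of_real L - h (of_real R * w)))"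
  have inR: "norm (of_real R * w) < R" if "norm w < 1" for w :: complex
    using that R by (simp add: norm_mult)
  have ne: "2 * of_real L - h (of_real R * w) \<noteq> 0" if "norm w < 1" for w
    using re[OF inR[OF that]] L by (auto simp: complex_eq_iff)
  have hol: "\<phi> holomorphic_on ball 0 1"
  proof -
    have "(h \<circ> (\<lambda>w. of_real R * w)) holomorphic_on ball 0 1"
      by (rule holomorphic_on_compose_gen[OF _ holh]) (use inR in \<open>auto intro!: holomorphic_intros\<close>)
    then show ?thesis
      unfolding \<phi>_def o_def using ne by (auto intro!: holomorphic_intros)
  qed
  have lt: "norm (\<phi> w) < 1" if "norm w < 1" for w
  proof -
    let ?u = "h (of_real R * w)"
    \<comment> \<open>The difference of the two squares is
      \<open>4 * L * (L - Re ?u)\<close>.\<close>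
    have "(norm ?u)\<^sup>2 < (norm (2 * of_real L - ?u))\<^sup>2"
      using mult_strict_left_mono[OF re[OF inR[OF that]] L]
      unfolding cmod_power2 by (simp add: power2_eq_square algebra_simps)
    then have "norm ?u < norm (2 * of_real L - ?u)"
      by (rule power2_less_imp_less) simp
    then show ?thesis
      using ne[OF that] by (simp add: \<phi>_def norm_divide)
  qed
  define w where "w = z / of_real R"
  have w: "norm w < 1" "of_real R * w = z" "norm w = norm z / R"
    using R z by (auto simp: w_def norm_divide)
  have "norm (\<phi> w) \<le> norm w"
    by (rule Schwarz_Lemma(1)[OF hol _ lt w(1)]) (use \<open>h 0 = 0\<close> in \<open>auto simp: \<phi>_def\<close>)
  then have "norm (h z / (2 * of_real L - h z)) \<le> norm z / R"
    unfolding \<phi>_def w .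
  then have "R * norm (h z) \<le> norm z * norm (2 * of_real L - h z)"
    using ne[OF w(1)] R unfolding w norm_divide by (simp add: field_simps)
  also have "\<dots> \<le> norm z * (2 * L + norm (h z))"
    using norm_triangle_ineq4[of "2 * of_real L" "h z"] L
    by (intro mult_left_mono) (auto simp: norm_mult)
  finally show ?thesis by (simp add: algebra_simps)
qed

section \<open>Bounds obtained from holomorphic logarithms\<close>

lemma holomorphic_log_ball:
  assumes "f holomorphic_on ball 0 R" "\<And>z. norm z < R \<Longrightarrow> f z \<noteq> 0"
  obtains g where "g holomorphic_on ball 0 R" "\<And>z. norm z < R \<Longrightarrow> f z = exp (g z)"
proof -
  have "simply_connected (ball (0::complex) R)"
    by (simp add: convex_imp_simply_connected)
  then show ?thesis
    using that assms simply_connected_eq_holomorphic_log[of "ball 0 R"] by (metis mem_ball_0 open_ball)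
qed

text \<open>The moduli of F fill an interval missing 1. If they lie above 1, then
  \<open>F = exp G\<close> with \<open>Re G > 0\<close>, and Borel-Caratheodory for
  \<open>G 0 - G\<close> gives \<open>Re (G z) \<le> 3 * Re (G 0)\<close>. The exponent 3 is
  Harnack's constant \<open>(R + r) / (R - r)\<close> at \<open>r = R / 2\<close>.\<close>

lemma norm_le_of_norm_neq_1:
  assumes holF: "F holomorphic_on ball 0 R" and ne: "\<And>z. norm z < R \<Longrightarrow> norm (F z) \<noteq> 1"
    and z: "2 * norm z \<le> R" "0 < R"
  shows "norm (F z) \<le> max 1 (norm (F 0) ^ 3)"
proof -
  have zR: "norm z < R" using z norm_ge_zero[of z] by linarith
  have conn: "connected ((\<lambda>z. norm (F z)) ` ball 0 R)"
    by (intro connected_continuous_image continuous_intros holomorphic_on_imp_continuous_on holF) auto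
  show ?thesis
  proof (cases "norm (F z) \<le> 1")
    case False
    have gt: "norm (F w) > 1" if "norm w < R" for w
    proof (rule ccontr)
      assume "\<not> norm (F w) > 1"
      then have "1 \<in> (\<lambda>z. norm (F z)) ` ball 0 R"
        using False that zR
        by (intro connectedD_interval[OF conn imageI[of w] imageI[of z]]) auto
      then show False using ne by force
    qed
    then have "F w \<noteq> 0" if "norm w < R" for w
      using that by force
    with holF obtain G where G: "G holomorphic_on ball 0 R" "\<And>z. norm z < R \<Longrightarrow> F z = exp (G z)"
      using holomorphic_log_ball by blast
    have ReG: "Re (G w) > 0" if "norm w < R" for w
      using gt[OF that] G(2)[OF that] by simp
    have "(R - norm z) * norm (G 0 - G z) \<le> 2 * Re (G 0) * norm z"
      using G(1) ReG zR by (intro borel_caratheodory[where h = "\<lambda>w. G 0 - G w"]) (auto intro!: holomorphic_intros)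
    also have "\<dots> \<le> 2 * Re (G 0) * (R - norm z)"
      using ReG[of 0] z by (intro mult_left_mono) auto
    finally have "norm (G 0 - G z) \<le> 2 * Re (G 0)"
      using zR by (simp add: mult.commute[of _ "R - norm z"] mult.assoc)
    then have "Re (G z) \<le> 3 * Re (G 0)"
      using abs_Re_le_cmod[of "G 0 - G z"] by simp
    then have "exp (Re (G z)) \<le> exp (Re (G 0)) ^ 3"
      by (simp flip: exp_of_nat_mult)
    then show ?thesis
      using G(2)[OF zR] G(2)[of 0] z by simp
  qed auto
qed

text \<open>Zero-freeness makes the derivatives at the centre proportional to
  \<open>norm (f 0)\<close> up to powers of a logarithm, whereas Cauchy's inequality on the whole
  disc would only give a multiple of K.\<close>

lemma higher_deriv_le_log:
  assumes holf: "f holomorphic_on ball 0 R" and R: "0 < R"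
    and nz: "\<And>z. norm z < R \<Longrightarrow> f z \<noteq> 0" and le: "\<And>z. norm z < R \<Longrightarrow> norm (f z) \<le> K"
  shows "norm ((deriv ^^ j) f 0) \<le> fact j * (exp 2 * norm (f 0)) * (2 * (1 + ln (K / norm (f 0))) / R) ^ j"
proof -
  \<comment> \<open>The summand 1 makes \<open>Re (u z - u 0) < L\<close> strict and gives
    \<open>L \<ge> 1\<close>, hence \<open>2 * t \<le> R\<close> below.\<close>
  define L where "L = 1 + ln (K / norm (f 0))"
  have f0: "f 0 \<noteq> 0" "norm (f 0) \<le> K" using nz[of 0] le[of 0] R by auto
  have K: "K > 0" using f0 by (metis less_le_trans zero_less_norm_iff)
  have L: "L \<ge> 1" using f0 K by (simp add: L_def)
  obtain u where u: "u holomorphic_on ball 0 R" "\<And>z. norm z < R \<Longrightarrow> f z = exp (u z)"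
    using holomorphic_log_ball[OF holf nz] by blast
  have re: "Re (u z - u 0) < L" if "norm z < R" for z
  proof -
    have "Re (u z) = ln (norm (f z))" using u(2)[OF that] by simp
    moreover have "Re (u 0) = ln (norm (f 0))" using u(2)[of 0] R by simp
    moreover have "ln (norm (f z)) \<le> ln K" using le[OF that] nz[OF that] K by (subst ln_le_cancel_iff) auto
    ultimately show ?thesis using f0 K by (simp add: L_def ln_div)
  qed
  \<comment> \<open>On this small circle the logarithm of f varies by at most 2, so that Cauchy's inequality
    costs only a power of L.\<close>
  define t where "t = R / (2 * L)"
  have t: "0 < t" "2 * t \<le> R" "t < R" "2 * L * t = R" using R L by (auto simp: t_def field_simps)
  have sub: "cball 0 t \<subseteq> ball 0 R" using t(3) by auto
  have "norm (f z) \<le> exp 2 * norm (f 0)" if z: "norm z = t" for z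
  proof -
    have zR: "norm z < R" using z t by simp
    have "(R - norm z) * norm (u z - u 0) \<le> 2 * L * norm z"
      using u(1) re zR by (intro borel_caratheodory[where h = "\<lambda>w. u w - u 0"]) (auto intro!: holomorphic_intros)
    \<comment> \<open>Here \<open>2 * L * t = R\<close>, and \<open>R \<le> 2 * (R - t)\<close>
      because \<open>2 * t \<le> R\<close>.\<close>
    also have "\<dots> \<le> (R - norm z) * 2" using z t by simp
    finally have "norm (u z - u 0) \<le> 2"
      using zR by (simp only: mult_le_cancel_left)
    then have "Re (u z) \<le> 2 + Re (u 0)" using abs_Re_le_cmod[of "u z - u 0"] by simp
    then have "exp (Re (u z)) \<le> exp 2 * exp (Re (u 0))" by (simp flip: exp_add)
    then show ?thesis using u(2)[OF zR] u(2)[of 0] R by simp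
  qed
  then have "norm ((deriv ^^ j) f 0) \<le> fact j * (exp 2 * norm (f 0)) / t ^ j"
    using sub t(1,3)
    by (intro Cauchy_inequality holomorphic_on_imp_continuous_on holomorphic_on_subset[OF holf]) auto
  also have "\<dots> = fact j * (exp 2 * norm (f 0)) * (2 * L / R) ^ j"
    by (simp add: t_def power_divide)
  finally show ?thesis by (simp add: L_def)
qed

text \<open>With \<open>T = a * L ^ k\<close>, powers of L grow more slowly than
  \<open>exp L\<close>, so \<open>T ^ 6 \<le> D * S ^ 3\<close>. If \<open>T > 1\<close>, then also
  \<open>S \<le> (1 + C) * T\<close>, and comparing \<open>T ^ 6\<close> with
  \<open>E * T ^ 3\<close> bounds T. The bound B is independent of a, which may be arbitrarily close
  to 0.\<close>

lemma bounded_of_log_power_bound: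
  fixes A C C1 :: real and k :: nat
  assumes "A \<ge> 1" "C \<ge> 0" "C1 > 0" "k \<ge> 1"
  shows "\<exists>B. \<forall>S a. S \<ge> 1 \<longrightarrow> 0 < a \<longrightarrow> a \<le> A \<longrightarrow> a \<le> C1 * S ^ 3 \<longrightarrow>
    S \<le> 1 + C * (a * (1 + ln (C1 * S ^ 3 / a)) ^ k) \<longrightarrow> S \<le> B"
proof -
  define D where "D = A ^ 5 * real (6 * k) ^ (6 * k) * exp 1 * C1"
  define E where "E = D * (1 + C) ^ 3"
  have D: "D \<ge> 0" using assms by (simp add: D_def)
  show ?thesis
  proof (intro exI[of _ "1 + C * max 1 E"] allI impI)
    fix S a assume S: "S \<ge> 1" and a: "0 < a" "a \<le> A" "a \<le> C1 * S ^ 3"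
      and le: "S \<le> 1 + C * (a * (1 + ln (C1 * S ^ 3 / a)) ^ k)"
    define L where "L = 1 + ln (C1 * S ^ 3 / a)"
    define T where "T = a * L ^ k"
    have X: "C1 * S ^ 3 / a \<ge> 1" using a by simp
    have L: "L \<ge> 1" using X by (simp add: L_def)
    have T0: "T \<ge> 0" using L a by (simp add: T_def)
    have eL: "exp L = exp 1 * (C1 * S ^ 3 / a)"
      using X by (simp add: L_def exp_add)
    \<comment> \<open>Raising \<open>x \<le> exp x\<close> at \<open>x = L / (6 * k)\<close> to the
      power \<open>6 * k\<close> compares \<open>L ^ (6 * k)\<close> with
      \<open>exp L\<close>.\<close>
    have "L / real (6 * k) \<le> exp (L / real (6 * k))"
      using exp_ge_add_one_self[of "L / real (6 * k)"] by linarith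
    then have "(L / real (6 * k)) ^ (6 * k) \<le> exp (L / real (6 * k)) ^ (6 * k)"
      using L by (intro power_mono) auto
    also have "\<dots> = exp L"
      using \<open>k \<ge> 1\<close> by (simp flip: exp_of_nat_mult)
    finally have "L ^ (6 * k) \<le> real (6 * k) ^ (6 * k) * exp L"
      using \<open>k \<ge> 1\<close> by (simp add: power_divide field_simps)
    then have "T ^ 6 \<le> a ^ 6 * (real (6 * k) ^ (6 * k) * exp L)"
      using a by (simp add: T_def power_mult_distrib mult.commute[of 6] flip: power_mult)
    \<comment> \<open>One of the six factors a cancels the denominator in \<open>exp L\<close>; this
      keeps the estimate uniform as a tends to 0.\<close>
    also have "\<dots> = a ^ 5 * (real (6 * k) ^ (6 * k) * exp 1 * C1 * S ^ 3)"
      using a by (simp add: eL power_eq_if field_simps)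
    also have "\<dots> \<le> A ^ 5 * (real (6 * k) ^ (6 * k) * exp 1 * C1 * S ^ 3)"
      using a assms S by (intro mult_right_mono power_mono) auto
    finally have T6: "T ^ 6 \<le> D * S ^ 3" by (simp add: D_def mult_ac)
    have "T \<le> max 1 E"
    proof (cases "T \<le> 1")
      case False
      have "S \<le> (1 + C) * T" using le False by (simp add: T_def L_def algebra_simps)
      then have "S ^ 3 \<le> ((1 + C) * T) ^ 3" using S by (intro power_mono) auto
      then have "D * S ^ 3 \<le> D * ((1 + C) * T) ^ 3" using D by (rule mult_left_mono)
      also have "\<dots> = E * T ^ 3" by (simp add: E_def power_mult_distrib)
      finally have "T ^ 3 * T ^ 3 \<le> E * T ^ 3" using T6 by (simp flip: power_add)
      then have "T ^ 3 \<le> E" using False by (simp only: mult_le_cancel_right) simp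
      moreover have "T \<le> T ^ 3" using False by (intro self_le_power) auto
      ultimately show ?thesis by simp
    qed simp
    then have "C * T \<le> C * max 1 E" using assms(2) by (intro mult_left_mono)
    then show "S \<le> 1 + C * max 1 E" using le by (simp add: T_def L_def)
  qed
qed

text \<open>Taylor's formula bounds f by the derivatives at 0, and the logarithmic estimate bounds
  these by f; the preceding lemma closes the circle. The order of the quantifiers matters: B is
  fixed before f.\<close>

lemma zero_free_bound:
  assumes "k \<ge> 1" "0 < R"
  shows "\<exists>B. \<forall>f. f holomorphic_on ball 0 R \<longrightarrow> (\<forall>z\<in>ball 0 R. f z \<noteq> 0) \<longrightarrow>
    (\<forall>z\<in>ball 0 R. norm ((deriv ^^ k) f z) \<noteq> 1) \<longrightarrow> norm (f 0) \<le> A \<longrightarrow>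
    (\<forall>z\<in>ball 0 (R / 2). norm (f z) \<le> B)"
proof -
  \<comment> \<open>Since \<open>Q \<ge> 1\<close>, all powers of \<open>norm z\<close> up to the
    k-th are at most \<open>Q ^ k\<close>. In \<open>C1\<close>, one \<open>Q ^ k\<close> pays for
    the Taylor polynomial and one for the remainder. The factor \<open>4 / R\<close> in C is
    \<open>2 / (R / 2)\<close>, from the derivative estimate on the disc of radius
    \<open>R / 2\<close>.\<close>
  define Q where "Q = max 1 R"
  define C1 where "C1 = 2 * Q ^ k"
  define C where "C = (\<Sum>j\<le>k. fact j * exp 2 * (4 / R) ^ j)"
  have Q: "Q \<ge> 1" "Q \<ge> R" by (auto simp: Q_def)
  have C1: "C1 > 0" using Q by (simp add: C1_def)
  have C0: "C \<ge> 0" using \<open>0 < R\<close> by (auto simp: C_def intro!: sum_nonneg)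
  obtain B where B: "\<And>S a. S \<ge> 1 \<Longrightarrow> 0 < a \<Longrightarrow> a \<le> max 1 A \<Longrightarrow> a \<le> C1 * S ^ 3 \<Longrightarrow>
    S \<le> 1 + C * (a * (1 + ln (C1 * S ^ 3 / a)) ^ k) \<Longrightarrow> S \<le> B"
    using bounded_of_log_power_bound[OF _ C0 C1 assms(1), of "max 1 A"] by auto
  show ?thesis
  proof (intro exI[of _ "C1 * B ^ 3"] allI impI)
    fix f assume hol: "f holomorphic_on ball 0 R" and nz: "\<forall>z\<in>ball 0 R. f z \<noteq> 0"
      and ne: "\<forall>z\<in>ball 0 R. norm ((deriv ^^ k) f z) \<noteq> 1" and fA: "norm (f 0) \<le> A"
    \<comment> \<open>The summand 1 gives \<open>S \<le> S ^ 3\<close> and lets \<open>S ^ 3\<close>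
      absorb the maximum with 1 in the bound for the k-th derivative.\<close>
    define S where "S = 1 + (\<Sum>j\<le>k. norm ((deriv ^^ j) f 0))"
    have S1: "S \<ge> 1" by (simp add: S_def sum_nonneg)
    have Sj: "norm ((deriv ^^ j) f 0) \<le> S" if "j \<le> k" for j
      using member_le_sum[of j "{..k}" "\<lambda>j. norm ((deriv ^^ j) f 0)"] that by (simp add: S_def)
    have SS: "S \<le> S ^ 3" using S1 by (intro self_le_power) auto
    have hd: "(deriv ^^ j) f holomorphic_on ball 0 R" for j
      by (rule holomorphic_higher_deriv[OF hol open_ball])
    have Fk: "norm ((deriv ^^ k) f z) \<le> S ^ 3" if "norm z \<le> R / 2" for z
    proof -
      have "norm ((deriv ^^ k) f z) \<le> max 1 (norm ((deriv ^^ k) f 0) ^ 3)"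
        using ne that \<open>0 < R\<close> by (intro norm_le_of_norm_neq_1[OF hd]) auto
      also have "\<dots> \<le> S ^ 3"
        using S1 Sj[of k] by (auto intro: power_mono)
      finally show ?thesis .
    qed
    have fz: "norm (f z) \<le> C1 * S ^ 3" if z: "norm z \<le> R / 2" for z
    proof -
      \<comment> \<open>The Taylor polynomial stops at degree \<open>k - 1\<close>, so that the
        remainder is governed by the k-th derivative.\<close>
      obtain m where m: "k = Suc m" using assms(1) by (cases k) auto
      have zQ: "norm z \<le> Q" using z Q \<open>0 < R\<close> by linarith
      have "norm ((deriv ^^ 0) f z - (\<Sum>i\<le>m. (deriv ^^ i) f 0 * (z - 0) ^ i / fact i))
          \<le> S ^ 3 * norm (z - 0) ^ Suc m / fact m"
      proof (rule complex_Taylor[of "cball 0 (R / 2)"])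
        fix i x assume "x \<in> cball (0::complex) (R / 2)"
        then have "x \<in> ball 0 R" using \<open>0 < R\<close> by auto
        then show "((deriv ^^ i) f has_field_derivative (deriv ^^ Suc i) f x) (at x within cball 0 (R / 2))"
          using holomorphic_derivI[OF hd[of i] open_ball] by (auto intro: has_field_derivative_at_within)
      next
        fix x assume "x \<in> cball (0::complex) (R / 2)"
        then show "norm ((deriv ^^ Suc m) f x) \<le> S ^ 3" using Fk[of x] by (simp add: m)
      qed (use z \<open>0 < R\<close> in auto)
      also have "\<dots> \<le> S ^ 3 * Q ^ k"
      proof -
        have "S ^ 3 * norm z ^ Suc m / fact m \<le> S ^ 3 * norm z ^ Suc m / 1"
          using S1 by (intro divide_left_mono mult_nonneg_nonneg) auto
        also have "\<dots> \<le> S ^ 3 * Q ^ Suc m"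
          using S1 zQ by (simp add: mult_left_mono power_mono del: power_Suc)
        finally show ?thesis by (simp add: m)
      qed
      finally have 1: "norm (f z - (\<Sum>i\<le>m. (deriv ^^ i) f 0 * z ^ i / fact i)) \<le> S ^ 3 * Q ^ k"
        by simp
      have "norm (\<Sum>i\<le>m. (deriv ^^ i) f 0 * z ^ i / fact i) \<le> (\<Sum>i\<le>m. norm ((deriv ^^ i) f 0) * Q ^ k)"
      proof (rule sum_norm_le)
        fix i assume i: "i \<in> {..m}"
        have "norm z ^ i \<le> Q ^ i" using zQ by (intro power_mono) auto
        also have "\<dots> \<le> Q ^ k" using Q i m by (intro power_increasing) auto
        finally have "norm z ^ i / fact i \<le> Q ^ k / 1"
          using Q by (intro frac_le) auto
        then have "norm ((deriv ^^ i) f 0) * (norm z ^ i / fact i) \<le> norm ((deriv ^^ i) f 0) * Q ^ k"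
          by (intro mult_left_mono) auto
        then show "norm ((deriv ^^ i) f 0 * z ^ i / fact i) \<le> norm ((deriv ^^ i) f 0) * Q ^ k"
          by (simp add: norm_mult norm_divide norm_power)
      qed
      also have "\<dots> \<le> S * Q ^ k"
        using Q by (auto simp: S_def m simp flip: sum_distrib_right intro!: mult_right_mono)
      also have "\<dots> \<le> S ^ 3 * Q ^ k" using SS Q by (intro mult_right_mono) auto
      finally show ?thesis
        using 1 norm_triangle_sub[of "f z" "\<Sum>i\<le>m. (deriv ^^ i) f 0 * z ^ i / fact i"]
        by (simp add: C1_def) (simp add: mult_ac)
    qed
    define a where "a = norm (f 0)"
    define L where "L = 1 + ln (C1 * S ^ 3 / a)"
    have a: "0 < a" "a \<le> max 1 A" "a \<le> C1 * S ^ 3"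
      using nz fA fz[of 0] \<open>0 < R\<close> by (auto simp: a_def)
    have L: "L \<ge> 1" using a by (simp add: L_def)
    have "S \<le> 1 + (\<Sum>j\<le>k. (fact j * exp 2 * (4 / R) ^ j) * (a * L ^ k))"
      unfolding S_def
    proof (intro add_left_mono sum_mono)
      fix j assume j: "j \<in> {..k}"
      \<comment> \<open>On the disc of radius \<open>R / 2\<close>, \<open>fz\<close> supplies the
        upper bound \<open>K = C1 * S ^ 3\<close>.\<close>
      have "norm ((deriv ^^ j) f 0) \<le> fact j * (exp 2 * norm (f 0)) * (2 * (1 + ln (C1 * S ^ 3 / norm (f 0))) / (R / 2)) ^ j"
        using nz fz \<open>0 < R\<close> by (intro higher_deriv_le_log) (auto intro: holomorphic_on_subset[OF hol])
      also have "\<dots> = fact j * exp 2 * (4 / R) ^ j * (a * L ^ j)"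
        unfolding a_def[symmetric] L_def[symmetric]
        using power_mult_distrib[of "4 / R" L j] by (simp add: algebra_simps)
      also have "\<dots> \<le> fact j * exp 2 * (4 / R) ^ j * (a * L ^ k)"
        using L a j \<open>0 < R\<close> by (intro mult_left_mono power_increasing) auto
      finally show "norm ((deriv ^^ j) f 0) \<le> fact j * exp 2 * (4 / R) ^ j * (a * L ^ k)" .
    qed
    then have "S \<le> B"
      using S1 a by (intro B[of S a]) (auto simp: C_def L_def simp flip: sum_distrib_right)
    then have "C1 * S ^ 3 \<le> C1 * B ^ 3"
      using S1 C1 by (intro mult_left_mono power_mono) auto
    then show "\<forall>z\<in>ball 0 (R / 2). norm (f z) \<le> C1 * B ^ 3"
      using fz by (auto intro!: order_trans[OF fz])
  qed
qed


section \<open>Polydiscs and slices\<close>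

text \<open>The open ball of the maximum norm: coordinates can be moved independently inside
  it.\<close>

definition polydisc :: "complex ^ 'n \<Rightarrow> real \<Rightarrow> (complex ^ 'n) set" where
  "polydisc z R = {w. \<forall>j. norm (w $ j - z $ j) < R}"

lemma open_polydisc: "open (polydisc z R)"
proof -
  have "polydisc z R = (\<Inter>j. {w. norm (w $ j - z $ j) < R})" by (auto simp: polydisc_def)
  then show ?thesis by (auto intro!: open_INT open_Collect_less continuous_intros)
qed

lemma convex_polydisc: "convex (polydisc z R)"
proof -
  have "polydisc z R = (\<Inter>j. {w. w $ j \<in> ball (z $ j) R})"
    by (auto simp: polydisc_def dist_norm norm_minus_commute)
  also have "\<dots> = (\<Inter>j. (\<lambda>w. w $ j) -` ball (z $ j) R)"
    by auto
  finally show ?thesis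
    by (auto intro!: convex_INT convex_linear_vimage bounded_linear.linear[OF bounded_linear_vec_nth])
qed

lemma centre_in_polydisc: "R > 0 \<Longrightarrow> z \<in> polydisc z R"
  by (simp add: polydisc_def)

lemma polydisc_sym: "w \<in> polydisc z R \<longleftrightarrow> z \<in> polydisc w R"
  by (simp add: polydisc_def norm_minus_commute)

lemma polydisc_add:
  assumes "x \<in> polydisc y r" "y \<in> polydisc z s"
  shows "x \<in> polydisc z (r + s)"
  unfolding polydisc_def
proof safe
  fix j
  have "x $ j - z $ j = (x $ j - y $ j) + (y $ j - z $ j)" by simp
  then have "norm (x $ j - z $ j) \<le> norm (x $ j - y $ j) + norm (y $ j - z $ j)"
    by (metis norm_triangle_ineq)
  then show "norm (x $ j - z $ j) < r + s"
    using assms unfolding polydisc_def by (smt (verit) mem_Collect_eq)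
qed

lemma ball_subset_polydisc: "ball z R \<subseteq> polydisc z R"
proof
  fix w assume "w \<in> ball z R"
  then have "norm (w - z) < R" by (simp add: dist_norm norm_minus_commute)
  then show "w \<in> polydisc z R"
    unfolding polydisc_def
    by (auto intro: le_less_trans[OF Finite_Cartesian_Product.norm_nth_le[of "w - z", simplified]])
qed

lemma polydisc_in_open:
  fixes z :: "complex ^ 'n"
  assumes "open D" "z \<in> D"
  obtains R where "R > 0" "polydisc z R \<subseteq> D"
proof -
  obtain e where e: "e > 0" "ball z e \<subseteq> D"
    using assms open_contains_ball by blast
  \<comment> \<open>The radius comes from bounding the Euclidean norm by the sum of the moduli of
    the \<open>CARD('n)\<close> coordinates.\<close>
  have "w \<in> ball z e" if w: "w \<in> polydisc z (e / CARD('n))" for w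
  proof -
    have "norm (w - z) \<le> (\<Sum>j\<in>UNIV. norm ((w - z) $ j))"
      unfolding norm_vec_def by (rule L2_set_le_sum) simp
    also have "\<dots> < (\<Sum>j\<in>(UNIV::'n set). e / CARD('n))"
      using w by (intro sum_strict_mono) (auto simp: polydisc_def)
    finally show ?thesis by (simp add: dist_norm norm_minus_commute)
  qed
  then have "polydisc z (e / CARD('n)) \<subseteq> D" using e(2) by blast
  then show ?thesis using e(1) that[of "e / CARD('n)"] by simp
qed

section \<open>One-variable slices along the coordinate axes\<close>

lemma axis_eq_scale: "axis j t = t *s (axis j 1 :: complex ^ 'n)"
  by (simp add: vec_eq_iff axis_def)

lemma axis_zero [simp]: "axis j 0 = 0"
  by (simp add: vec_eq_iff axis_def)

text \<open>The chain rule gives the real derivative \<open>L \<circ> axis j\<close>; complex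
  homogeneity of L turns it into multiplication by the number \<open>L (axis j 1)\<close>.\<close>

lemma slice_has_field_derivative:
  fixes z :: "complex ^ 'n"
  assumes "(f has_derivative L) (at (z + axis j t))" "\<And>c x. L (c *s x) = c * L x"
  shows "((\<lambda>s. f (z + axis j s)) has_field_derivative L (axis j 1)) (at t)"
proof -
  have "linear (axis j :: complex \<Rightarrow> complex ^ 'n)"
    by (rule linearI) (auto simp: vec_eq_iff axis_def)
  then have "((\<lambda>s. z + axis j s) has_derivative axis j) (at t)"
    using bounded_linear_imp_has_derivative[of "axis j :: complex \<Rightarrow> complex ^ 'n"]
    by (auto intro!: derivative_eq_intros simp: linear_conv_bounded_linear)
  from diff_chain_at[OF this] assms(1)
  have "((\<lambda>s. f (z + axis j s)) has_derivative L \<circ> axis j) (at t)"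
    by (simp add: o_def)
  moreover have "(L \<circ> axis j) s = L (axis j 1) * s" for s
    unfolding o_apply axis_eq_scale[of j s] assms(2) by (rule mult.commute)
  then have "L \<circ> axis j = (*) (L (axis j 1))"
    by (rule ext)
  ultimately show ?thesis by (simp add: has_field_derivative_def)
qed

lemma slice_holomorphic:
  assumes "holomorphic_on_n f D" "\<And>t. t \<in> S \<Longrightarrow> z + axis j t \<in> D"
  shows "(\<lambda>t. f (z + axis j t)) holomorphic_on S"
  unfolding holomorphic_on_def
proof
  fix t assume "t \<in> S"
  then obtain L where "(f has_derivative L) (at (z + axis j t))" "\<And>c x. L (c *s x) = c * L x"
    using assms unfolding holomorphic_on_n_def by blast
  then show "(\<lambda>t. f (z + axis j t)) field_differentiable at t within S"
    using slice_has_field_derivative[of f L z j t] field_differentiable_at_within field_differentiable_def by blast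
qed

text \<open>\<open>partial_k\<close> uses a new slice, differentiated at 0, for every point. The
  shift turns conditions at all points of a line into a condition on one function of one
  variable.\<close>

lemma partial_k_slice:
  "partial_k k j f (z + axis j t) = (deriv ^^ k) (\<lambda>s. f (z + axis j s)) t"
proof -
  have "axis j (t + s) = axis j t + axis j s" for s :: complex
    by (simp add: vec_eq_iff axis_def)
  then show ?thesis
    by (subst higher_deriv_shift_0) (simp add: partial_k_def o_def add.assoc)
qed

text \<open>The hypotheses in the form that restricts to slices: the unit vector is gone and each
  coordinate is treated separately.\<close>

definition avoiding :: "nat \<Rightarrow> (complex ^ 'n) set \<Rightarrow> (complex ^ 'n \<Rightarrow> complex) set" where
  "avoiding k D = {f. holomorphic_on_n f D \<and>
     (\<forall>z\<in>D. f z \<noteq> 0 \<and> (\<forall>j. norm (partial_k k j f z) \<noteq> 1))}"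

text \<open>Induction on the set J of coordinates in which w may differ from z. Each new coordinate
  costs one application of \<open>zero_free_bound\<close>, with the previous bound in the role of
  A.\<close>

lemma avoiding_bound:
  fixes D :: "(complex ^ 'n) set"
  assumes "k \<ge> 1" "R > 0"
  shows "\<exists>B. \<forall>f\<in>avoiding k D. \<forall>z. polydisc z R \<subseteq> D \<longrightarrow> norm (f z) \<le> A \<longrightarrow>
    (\<forall>w\<in>polydisc z (R / 2). norm (f w) \<le> B)"
proof -
  have "\<exists>B. \<forall>f\<in>avoiding k D. \<forall>z. polydisc z R \<subseteq> D \<longrightarrow> norm (f z) \<le> A \<longrightarrow>
    (\<forall>w\<in>polydisc z (R / 2). (\<forall>j. j \<notin> J \<longrightarrow> w $ j = z $ j) \<longrightarrow> norm (f w) \<le> B)" for J :: "'n set"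
    using finite[of J]
  proof (induction J rule: finite_induct)
    case empty
    show ?case by (intro exI[of _ A]) (auto simp: vec_eq_iff[symmetric])
  next
    case (insert i J)
    obtain B where B: "\<And>f z w. f \<in> avoiding k D \<Longrightarrow> polydisc z R \<subseteq> D \<Longrightarrow> norm (f z) \<le> A \<Longrightarrow>
      w \<in> polydisc z (R / 2) \<Longrightarrow> (\<And>j. j \<notin> J \<Longrightarrow> w $ j = z $ j) \<Longrightarrow> norm (f w) \<le> B"
      using insert.IH by blast
    obtain B' where B': "\<And>f z. f holomorphic_on ball 0 R \<Longrightarrow> (\<And>z. z \<in> ball 0 R \<Longrightarrow> f z \<noteq> 0) \<Longrightarrow>
      (\<And>z. z \<in> ball 0 R \<Longrightarrow> norm ((deriv ^^ k) f z) \<noteq> 1) \<Longrightarrow> norm (f 0) \<le> B \<Longrightarrow>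
      z \<in> ball 0 (R / 2) \<Longrightarrow> norm (f z) \<le> B'"
      using zero_free_bound[OF assms, of B] by blast
    show ?case
    proof (intro exI[of _ B'] ballI allI impI)
      fix f z w
      assume f: "f \<in> avoiding k D" and zR: "polydisc z R \<subseteq> D" and fz: "norm (f z) \<le> A"
        and w: "w \<in> polydisc z (R / 2)" "\<forall>j. j \<notin> insert i J \<longrightarrow> w $ j = z $ j"
      \<comment> \<open>Resetting coordinate i gives a point covered by the induction hypothesis; w
        lies on the slice through v in direction i.\<close>
      define v where "v = (\<chi> j. if j = i then z $ i else w $ j)"
      have v: "v \<in> polydisc z (R / 2)"
        using w(1) \<open>R > 0\<close> by (auto simp: polydisc_def v_def)
      have wv: "w = v + axis i (w $ i - z $ i)"
        by (auto simp: vec_eq_iff v_def axis_def)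
      have inD: "v + axis i t \<in> D" if "t \<in> ball 0 R" for t
      proof -
        have "norm (w $ j - z $ j) < R" for j
          using w(1) \<open>R > 0\<close> by (auto simp: polydisc_def intro: less_trans[of _ "R / 2"])
        then have "v + axis i t \<in> polydisc z R"
          using that by (auto simp: polydisc_def v_def axis_def)
        then show ?thesis using zR by blast
      qed
      have "norm (f (v + axis i (w $ i - z $ i))) \<le> B'"
      proof (rule B'[where f = "\<lambda>t. f (v + axis i t)"])
        show "(\<lambda>t. f (v + axis i t)) holomorphic_on ball 0 R"
          using f inD by (intro slice_holomorphic[of _ D]) (auto simp: avoiding_def)
        show "f (v + axis i t) \<noteq> 0" if "t \<in> ball 0 R" for t
          using f inD[OF that] by (auto simp: avoiding_def)
        show "norm ((deriv ^^ k) (\<lambda>t. f (v + axis i t)) t) \<noteq> 1" if "t \<in> ball 0 R" for t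
          using f inD[OF that] by (auto simp: avoiding_def simp flip: partial_k_slice)
        have "norm (f v) \<le> B"
          using w(2) by (intro B[OF f zR fz v]) (auto simp: v_def)
        then show "norm (f (v + axis i 0)) \<le> B" by simp
        show "w $ i - z $ i \<in> ball 0 (R / 2)"
          using w(1) by (auto simp: polydisc_def)
      qed
      then show "norm (f w) \<le> B'" by (simp flip: wv)
    qed
  qed
  from this[of UNIV] show ?thesis by simp
qed

text \<open>Cauchy's inequality on slices bounds each partial derivative by
  \<open>4 * B / R\<close>, their sum bounds the operator norm of the derivative, and the mean value
  inequality applies on the convex polydisc.\<close>

lemma bounded_holomorphic_lipschitz:
  fixes z :: "complex ^ 'n"
  assumes hol: "holomorphic_on_n f D" and sub: "polydisc z R \<subseteq> D" and R: "R > 0"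
    and B: "\<And>w. w \<in> polydisc z R \<Longrightarrow> norm (f w) \<le> B"
    and xy: "x \<in> polydisc z (R / 2)" "y \<in> polydisc z (R / 2)"
  shows "norm (f x - f y) \<le> CARD('n) * (4 * B / R) * norm (x - y)"
proof -
  have "\<exists>L. (f has_derivative L) (at w) \<and> (\<forall>c x. L (c *s x) = c * L x)" if "w \<in> D" for w
    using hol that by (auto simp: holomorphic_on_n_def)
  then obtain L where L: "\<And>w. w \<in> D \<Longrightarrow> (f has_derivative L w) (at w)"
    "\<And>w c x. w \<in> D \<Longrightarrow> L w (c *s x) = c * L w x"
    by metis
  have half: "w \<in> polydisc z R" if "w \<in> polydisc z (R / 2)" for w
    using polydisc_add[OF that centre_in_polydisc, of "R / 2"] R by simp
  show ?thesis
  proof (rule differentiable_bound[OF convex_polydisc _ _ xy, where f' = L])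
    fix w assume w: "w \<in> polydisc z (R / 2)"
    then have wD: "w \<in> D" using half sub by blast
    show "(f has_derivative L w) (at w within polydisc z (R / 2))"
      using L(1)[OF wD] by (rule has_derivative_at_withinI)
    have Lj: "norm (L w (axis j 1)) \<le> 4 * B / R" for j
    proof -
      have inR: "w + axis j t \<in> polydisc z R" if "t \<in> ball 0 (R / 2)" for t
      proof -
        have "w + axis j t \<in> polydisc w (R / 2)"
          using that R by (auto simp: polydisc_def axis_def)
        then show ?thesis using polydisc_add[OF _ w] by fastforce
      qed
      \<comment> \<open>Radius \<open>R / 4\<close> keeps the closed disc inside the open one where
        the slice is known to be holomorphic.\<close>
      have sub4: "cball 0 (R / 4) \<subseteq> ball (0::complex) (R / 2)" using R by auto
      have holj: "(\<lambda>t. f (w + axis j t)) holomorphic_on ball 0 (R / 2)"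
        using inR sub by (intro slice_holomorphic[OF hol]) auto
      have "norm ((deriv ^^ 1) (\<lambda>t. f (w + axis j t)) 0) \<le> fact 1 * B / (R / 4) ^ 1"
      proof (rule Cauchy_inequality)
        show "(\<lambda>t. f (w + axis j t)) holomorphic_on ball 0 (R / 4)"
          using R by (intro holomorphic_on_subset[OF holj]) auto
        show "continuous_on (cball 0 (R / 4)) (\<lambda>t. f (w + axis j t))"
          using holomorphic_on_imp_continuous_on[OF holj] sub4 continuous_on_subset by blast
        show "norm (f (w + axis j t)) \<le> B" if "norm (0 - t) = R / 4" for t
          using that R by (intro B inR) auto
      qed (use R in auto)
      moreover have "((\<lambda>t. f (w + axis j t)) has_field_derivative L w (axis j 1)) (at 0)"
        using L[OF wD] by (intro slice_has_field_derivative) auto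
      ultimately show ?thesis by (simp add: DERIV_imp_deriv mult.commute)
    qed
    show "onorm (L w) \<le> CARD('n) * (4 * B / R)"
    proof (rule onorm_bound)
      fix x
      interpret bounded_linear "L w" using L(1)[OF wD] by (rule has_derivative_bounded_linear)
      have "L w x = L w (\<Sum>j\<in>UNIV. x $ j *s axis j 1)" by (simp only: basis_expansion)
      also have "\<dots> = (\<Sum>j\<in>UNIV. x $ j * L w (axis j 1))"
        by (simp add: sum L(2)[OF wD])
      also have "norm \<dots> \<le> (\<Sum>j\<in>(UNIV::'n set). norm x * (4 * B / R))"
        by (rule sum_norm_le) (auto simp only: norm_mult intro!: mult_mono Lj Finite_Cartesian_Product.norm_nth_le norm_ge_zero)
      finally show "norm (L w x) \<le> CARD('n) * (4 * B / R) * norm x" by (simp add: mult_ac)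
      show "0 \<le> CARD('n) * (4 * B / R)" 
        using order_trans[OF norm_ge_zero Lj] by (intro mult_nonneg_nonneg) auto
    qed
  qed
qed

section \<open>Normality\<close>

text \<open>By Lindelof, countably many of the balls cover D. Arzela-Ascoli applies on each closed
  ball, the Lipschitz bound giving equicontinuity, and a diagonal subsequence serves all of
  them.\<close>

lemma locally_bounded_lipschitz_subsequence:
  fixes s :: "nat \<Rightarrow> 'a::euclidean_space \<Rightarrow> 'b::{banach,heine_borel}"
  assumes "D \<noteq> {}" and loc: "\<And>z. z \<in> D \<Longrightarrow> \<exists>e>0. cball z e \<subseteq> D \<and> (\<exists>M L. \<forall>m. \<forall>x\<in>cball z e.
     norm (s m x) \<le> M \<and> (\<forall>y\<in>cball z e. norm (s m x - s m y) \<le> L * norm (x - y)))"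
  shows "\<exists>r g. strict_mono r \<and> (\<forall>z\<in>D. \<exists>U. open U \<and> z \<in> U \<and> U \<subseteq> D \<and>
           uniform_limit U (\<lambda>m. s (r m)) g sequentially)"
proof -
  obtain e where e: "\<And>z. z \<in> D \<Longrightarrow> e z > 0" "\<And>z. z \<in> D \<Longrightarrow> cball z (e z) \<subseteq> D"
    "\<And>z. z \<in> D \<Longrightarrow> \<exists>M L. \<forall>m. \<forall>x\<in>cball z (e z).
      norm (s m x) \<le> M \<and> (\<forall>y\<in>cball z (e z). norm (s m x - s m y) \<le> L * norm (x - y))"
    using loc by metis
  obtain F' where F': "F' \<subseteq> (\<lambda>z. ball z (e z)) ` D" "countable F'" "\<Union>F' = (\<Union>z\<in>D. ball z (e z))"
    by (rule Lindelof[of "(\<lambda>z. ball z (e z)) ` D"]) auto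
  obtain C where C: "C \<subseteq> D" "countable C" "F' = (\<lambda>z. ball z (e z)) ` C"
    using countable_subset_image[of F' "\<lambda>z. ball z (e z)" D] F'(1,2) by blast
  have cover: "\<exists>c\<in>C. z \<in> ball c (e c)" if "z \<in> D" for z
  proof -
    have "z \<in> \<Union>F'" unfolding F'(3) using that e(1)[OF that] by (auto intro!: bexI[of _ z])
    then show ?thesis using C(3) by auto
  qed
  have "C \<noteq> {}" using cover \<open>D \<noteq> {}\<close> by blast
  define c where "c = from_nat_into C"
  have cD: "c i \<in> D" for i using C(1) from_nat_into[OF \<open>C \<noteq> {}\<close>] by (auto simp: c_def)
  define K where "K = (\<lambda>i. cball (c i) (e (c i)))"
  obtain r :: "nat \<Rightarrow> nat" where r: "strict_mono r" "\<And>i. uniformly_convergent_on (K i) (\<lambda>m. s ((id \<circ> r) m))"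
  proof (rule subsequence_diagonalization_lemma[of "\<lambda>i r. uniformly_convergent_on (K i) (\<lambda>m. s (r m))" id])
    fix i and r :: "nat \<Rightarrow> nat"
    obtain M L where Ki: "\<And>m x. x \<in> K i \<Longrightarrow> norm (s m x) \<le> M"
      "\<And>m x y. x \<in> K i \<Longrightarrow> y \<in> K i \<Longrightarrow> norm (s m x - s m y) \<le> L * norm (x - y)"
      using e(3)[OF cD[of i]] unfolding K_def by blast
    obtain g and k :: "nat \<Rightarrow> nat" where "strict_mono k"
      and g: "\<And>e. 0 < e \<Longrightarrow> \<exists>N. \<forall>n x. n \<ge> N \<and> x \<in> K i \<longrightarrow> norm (s (r (k n)) x - g x) < e"
    proof (rule Arzela_Ascoli[of "K i" "\<lambda>n. s (r n)" M])
      fix x and d :: real assume x: "x \<in> K i" and d: "0 < d"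
      show "\<exists>\<delta>>0. \<forall>n y. y \<in> K i \<and> norm (x - y) < \<delta> \<longrightarrow> norm (s (r n) x - s (r n) y) < d"
      proof (intro exI[of _ "d / (\<bar>L\<bar> + 1)"] conjI allI impI)
        fix n y assume y: "y \<in> K i \<and> norm (x - y) < d / (\<bar>L\<bar> + 1)"
        have "norm (s (r n) x - s (r n) y) \<le> L * norm (x - y)" using Ki(2) x y by blast
        also have "\<dots> \<le> (\<bar>L\<bar> + 1) * norm (x - y)" by (intro mult_right_mono) auto
        also have "\<dots> < d" using y by (simp add: field_simps)
        finally show "norm (s (r n) x - s (r n) y) < d" .
      qed (use d in \<open>simp add: add_nonneg_pos\<close>)
    next
      show "compact (K i)" by (simp add: K_def)
    qed (use Ki(1) in blast)+
    have "uniform_limit (K i) (\<lambda>n. s ((r \<circ> k) n)) g sequentially"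
      using g unfolding uniform_limit_sequentially_iff dist_norm o_def by blast
    then show "\<exists>k. strict_mono k \<and> uniformly_convergent_on (K i) (\<lambda>m. s ((r \<circ> k) m))"
      using \<open>strict_mono k\<close> uniformly_convergent_on_def by blast
  next
    \<comment> \<open>The diagonal sequence is only eventually drawn from each earlier subsequence,
      so convergence must survive a change of finitely many terms.\<close>
    fix i N and r k1 k2 :: "nat \<Rightarrow> nat"
    assume "uniformly_convergent_on (K i) (\<lambda>m. s ((r \<circ> k1) m))"
      and sub: "\<And>j. N \<le> j \<Longrightarrow> \<exists>j'\<ge>j. k2 j = k1 j'"
    then obtain g where g: "uniform_limit (K i) (\<lambda>m. s ((r \<circ> k1) m)) g sequentially"
      by (auto simp: uniformly_convergent_on_def)
    have "uniform_limit (K i) (\<lambda>m. s ((r \<circ> k2) m)) g sequentially"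
      unfolding uniform_limit_sequentially_iff
    proof (intro allI impI)
      fix d :: real assume "d > 0"
      then obtain N' where N': "\<And>n x. n \<ge> N' \<Longrightarrow> x \<in> K i \<Longrightarrow> dist (s ((r \<circ> k1) n) x) (g x) < d"
        using g unfolding uniform_limit_sequentially_iff by blast
      show "\<exists>N. \<forall>n\<ge>N. \<forall>x\<in>K i. dist (s ((r \<circ> k2) n) x) (g x) < d"
      proof (intro exI[of _ "max N N'"] allI ballI impI)
        fix n x assume n: "max N N' \<le> n" and x: "x \<in> K i"
        obtain j' where "j' \<ge> n" "k2 n = k1 j'" using sub[of n] n by auto
        then show "dist (s ((r \<circ> k2) n) x) (g x) < d" using N'[of j' x] n x by simp
      qed
    qed
    then show "uniformly_convergent_on (K i) (\<lambda>m. s ((r \<circ> k2) m))"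
      by (auto simp: uniformly_convergent_on_def)
  qed blast
  \<comment> \<open>The pointwise limit \<open>lim\<close> is the same function for every ball, so
    it serves as one limit on all of D.\<close>
  have "\<exists>U. open U \<and> z \<in> U \<and> U \<subseteq> D \<and>
      uniform_limit U (\<lambda>m. s (r m)) (\<lambda>x. lim (\<lambda>m. s (r m) x)) sequentially" if "z \<in> D" for z
  proof -
    obtain a where a: "a \<in> C" "z \<in> ball a (e a)" using cover[OF \<open>z \<in> D\<close>] by blast
    then obtain i where i: "a = c i"
      using from_nat_into_surj[OF C(2)] by (metis c_def)
    have "uniform_limit (K i) (\<lambda>m. s (r m)) (\<lambda>x. lim (\<lambda>m. s (r m) x)) sequentially"
      using r(2)[of i] by (simp add: uniformly_convergent_uniform_limit_iff)
    then have "uniform_limit (ball a (e a)) (\<lambda>m. s (r m)) (\<lambda>x. lim (\<lambda>m. s (r m) x)) sequentially"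
      by (rule uniform_limit_on_subset) (auto simp: K_def i)
    then show ?thesis
      using a e(2)[of a] C(1) by (intro exI[of _ "ball a (e a)"]) (auto simp: subset_iff)
  qed
  then show ?thesis using r(1) by blast
qed

section \<open>Normality of the avoiding class\<close>

lemma normal_family_on_subset:
  assumes "normal_family_on G D" "F \<subseteq> G"
  shows "normal_family_on F D"
  unfolding normal_family_on_def
  by (intro allI impI, rule assms(1)[unfolded normal_family_on_def, THEN spec, THEN mp],
      rule order_trans[OF _ assms(2)])

text \<open>Either the sequence tends to infinity at every point, or a subsequence is bounded at
  some \<open>z0\<close>. \<open>avoiding_bound\<close> makes the first alternative locally uniform
  and spreads the second over D.\<close>

lemma avoiding_normal:
  fixes D :: "(complex ^ 'n) set"
  assumes "open D" "connected D" "D \<noteq> {}" "k \<ge> 1"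
  shows "normal_family_on (avoiding k D) D"
  unfolding normal_family_on_def
proof (intro allI impI)
  fix s :: "nat \<Rightarrow> complex ^ 'n \<Rightarrow> complex" assume "range s \<subseteq> avoiding k D"
  then have s: "s m \<in> avoiding k D" for m by blast
  \<comment> \<open>Doubling the radius lets polydiscs of the same radius \<open>R z\<close> about
    all points of \<open>polydisc z (R z)\<close> fit into D, so one constant serves all these
    centres.\<close>
  have "\<exists>R>0. polydisc z (R + R) \<subseteq> D" if "z \<in> D" for z
    by (rule polydisc_in_open[OF \<open>open D\<close> that]) (metis field_sum_of_halves half_gt_zero)
  then obtain R where R: "\<And>z. z \<in> D \<Longrightarrow> R z > 0" "\<And>z. z \<in> D \<Longrightarrow> polydisc z (R z + R z) \<subseteq> D"
    by metis
  have RD: "polydisc w (R z) \<subseteq> D" if "z \<in> D" "w \<in> polydisc z (R z)" for z w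
    using R(2)[OF that(1)] polydisc_add[OF _ that(2)] by blast
  have half: "w \<in> polydisc z (R z)" if "z \<in> D" "w \<in> polydisc z (R z / 2)" for z w
    using polydisc_add[OF that(2) centre_in_polydisc[of "R z / 2"]] R(1)[OF that(1)] by simp
  show "\<exists>r. strict_mono r \<and>
        ((\<exists>g. \<forall>z\<in>D. \<exists>U. open U \<and> z \<in> U \<and> U \<subseteq> D \<and>
                 uniform_limit U (\<lambda>m. s (r m)) g sequentially)
         \<or> (\<forall>z\<in>D. \<exists>U. open U \<and> z \<in> U \<and> U \<subseteq> D \<and>
                 (\<forall>M. eventually (\<lambda>m. \<forall>w\<in>U. norm (s (r m) w) > M) sequentially)))"
  proof (cases "\<forall>z\<in>D. \<forall>M. eventually (\<lambda>m. norm (s m z) > M) sequentially")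
    case True
    have "\<exists>U. open U \<and> z \<in> U \<and> U \<subseteq> D \<and>
        (\<forall>M. eventually (\<lambda>m. \<forall>w\<in>U. norm (s (id m) w) > M) sequentially)" if z: "z \<in> D" for z
    proof (intro exI[of _ "polydisc z (R z / 2)"] conjI allI)
      show "polydisc z (R z / 2) \<subseteq> D"
        using half[OF z] RD[OF z centre_in_polydisc] R(1)[OF z] by blast
      fix M
      \<comment> \<open>The estimate is used in reverse: modulus at most M at a nearby w would force
        modulus at most B at z, because z lies in the polydisc about w.\<close>
      obtain B where B: "\<And>f z' w. f \<in> avoiding k D \<Longrightarrow> polydisc z' (R z) \<subseteq> D \<Longrightarrow> norm (f z') \<le> M \<Longrightarrow>
          w \<in> polydisc z' (R z / 2) \<Longrightarrow> norm (f w) \<le> B"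
        using avoiding_bound[OF \<open>k \<ge> 1\<close> R(1)[OF z], of D M] by blast
      have "eventually (\<lambda>m. norm (s m z) > B) sequentially"
        using True z by blast
      then show "eventually (\<lambda>m. \<forall>w\<in>polydisc z (R z / 2). norm (s (id m) w) > M) sequentially"
      proof eventually_elim
        case (elim m)
        show ?case
        proof (rule ballI, rule ccontr)
          fix w assume w: "w \<in> polydisc z (R z / 2)" and "\<not> norm (s (id m) w) > M"
          then have "norm (s m z) \<le> B"
            using RD[OF z half[OF z w]] w by (intro B[OF s]) (auto simp: polydisc_sym[of z])
          with elim show False by simp
        qed
      qed
    qed (use R(1)[OF z] in \<open>auto simp: open_polydisc centre_in_polydisc\<close>)
    then show ?thesis using strict_mono_id by blast
  next
    case False
    then obtain z0 M0 where z0: "z0 \<in> D" "\<not> eventually (\<lambda>m. norm (s m z0) > M0) sequentially"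
      by blast
    then have inf: "infinite {m. norm (s m z0) \<le> M0}"
      by (simp add: not_eventually frequently_cofinite[symmetric] cofinite_eq_sequentially not_less)
    obtain q :: "nat \<Rightarrow> nat" where q: "strict_mono q" "\<And>m. norm (s (q m) z0) \<le> M0"
      using infinite_enumerate[OF inf] by auto
    have step: "\<exists>B. \<forall>m. \<forall>w\<in>polydisc z' (R z / 2). norm (s (q m) w) \<le> B"
      if "z \<in> D" "z' \<in> polydisc z (R z)" and M: "\<And>m. norm (s (q m) z') \<le> M" for z z' M
    proof -
      obtain B where "\<forall>f\<in>avoiding k D. \<forall>z'. polydisc z' (R z) \<subseteq> D \<longrightarrow> norm (f z') \<le> M \<longrightarrow>
          (\<forall>w\<in>polydisc z' (R z / 2). norm (f w) \<le> B)"
        using avoiding_bound[OF \<open>k \<ge> 1\<close> R(1)[OF \<open>z \<in> D\<close>], of D M] by blast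
      then show ?thesis
        using s RD[OF that(1,2)] M by blast
    qed
    \<comment> \<open>Two points of a quarter polydisc differ by less than \<open>R a / 2\<close> in
      each coordinate, so boundedness passes from either to the other; connectedness carries it from
      \<open>z0\<close> to every point.\<close>
    have bdd: "\<exists>M. \<forall>m. norm (s (q m) z) \<le> M" if "z \<in> D" for z
    proof (rule connected_induction_simple[OF \<open>connected D\<close> z0(1) that])
      show "\<exists>M. \<forall>m. norm (s (q m) z0) \<le> M" using q(2) by blast
      fix a assume a: "a \<in> D"
      let ?T = "polydisc a (R a / 4)"
      have quarter: "x \<in> polydisc a (R a / 2)" if "x \<in> ?T" for x
        using polydisc_add[OF that centre_in_polydisc[of "R a / 4"]] R(1)[OF a] by simp
      have "\<exists>M. \<forall>m. norm (s (q m) y) \<le> M"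
        if x: "x \<in> ?T" and y: "y \<in> ?T" and "\<exists>M. \<forall>m. norm (s (q m) x) \<le> M" for x y
      proof -
        have "y \<in> polydisc x (R a / 2)"
          using polydisc_add[OF y x[unfolded polydisc_sym[of x]]] by simp
        moreover have "\<exists>B. \<forall>m. \<forall>w\<in>polydisc x (R a / 2). norm (s (q m) w) \<le> B"
          using step[OF a half[OF a quarter[OF x]]] that(3) by blast
        ultimately show ?thesis by blast
      qed
      moreover have "?T \<subseteq> D"
        using quarter half[OF a] RD[OF a centre_in_polydisc] R(1)[OF a] by blast
      then have "openin (top_of_set D) ?T" by (rule open_subset[OF _ open_polydisc])
      moreover have "a \<in> ?T" using R(1)[OF a] by (simp add: centre_in_polydisc)
      ultimately show "\<exists>T. openin (top_of_set D) T \<and> a \<in> T \<and> (\<forall>x\<in>T. \<forall>y\<in>T.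
          (\<exists>M. \<forall>m. norm (s (q m) x) \<le> M) \<longrightarrow> (\<exists>M. \<forall>m. norm (s (q m) y) \<le> M))"
        by (intro exI[of _ ?T] conjI ballI impI) assumption+
    qed
    have "\<exists>r g. strict_mono r \<and> (\<forall>z\<in>D. \<exists>U. open U \<and> z \<in> U \<and> U \<subseteq> D \<and>
           uniform_limit U (\<lambda>m. s (q (r m))) g sequentially)"
    proof (rule locally_bounded_lipschitz_subsequence[OF \<open>D \<noteq> {}\<close>])
      fix z assume z: "z \<in> D"
      obtain B where B: "\<And>m w. w \<in> polydisc z (R z / 2) \<Longrightarrow> norm (s (q m) w) \<le> B"
        using bdd[OF z] step[OF z centre_in_polydisc[OF R(1)[OF z]]] by blast
      have sub: "polydisc z (R z / 2) \<subseteq> D"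
        using half[OF z] RD[OF z centre_in_polydisc] R(1)[OF z] by blast
      \<comment> \<open>The Lipschitz lemma with radius \<open>R z / 2\<close> works on the polydisc
        of radius \<open>R z / 4\<close>, which contains this closed ball.\<close>
      define e where "e = R z / 8"
      have e: "e > 0" "cball z e \<subseteq> ball z (R z / 2 / 2)"
        using R(1)[OF z] by (auto simp: e_def)
      then have eP: "cball z e \<subseteq> polydisc z (R z / 2 / 2)"
        using ball_subset_polydisc by blast
      have eP': "cball z e \<subseteq> polydisc z (R z / 2)"
        using e(2) ball_subset_polydisc[of z "R z / 2"] R(1)[OF z] by fastforce
      have "norm (s (q m) x - s (q m) y) \<le> CARD('n) * (4 * B / (R z / 2)) * norm (x - y)"
        if "x \<in> cball z e" "y \<in> cball z e" for m x y
        using s[of "q m"] B eP that R(1)[OF z]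
        by (intro bounded_holomorphic_lipschitz[OF _ sub]) (auto simp: avoiding_def)
      then show "\<exists>e>0. cball z e \<subseteq> D \<and> (\<exists>M L. \<forall>m. \<forall>x\<in>cball z e. norm (s (q m) x) \<le> M \<and>
          (\<forall>y\<in>cball z e. norm (s (q m) x - s (q m) y) \<le> L * norm (x - y)))"
        using e(1) eP' sub B by (intro exI[of _ e]) blast
    qed
    then obtain r g where rg: "strict_mono r" "\<forall>z\<in>D. \<exists>U. open U \<and> z \<in> U \<and> U \<subseteq> D \<and>
           uniform_limit U (\<lambda>m. s ((q \<circ> r) m)) g sequentially"
      by auto
    have "strict_mono (q \<circ> r)" using q(1) rg(1) by (simp add: strict_mono_o)
    then show ?thesis using rg(2) by blast
  qed
qed

text \<open>If the derivative is p with \<open>norm p = 1\<close>, then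
  \<open>axis j (1 / p)\<close> is a unit vector whose pairing is
  \<open>p * (1 / p) = 1\<close>.\<close>

lemma partial_k_norm_neq_1:
  assumes "\<And>v. norm v = 1 \<Longrightarrow> Dk_pair k f z v \<noteq> 1"
  shows "norm (partial_k k j f z) \<noteq> 1"
proof
  assume 1: "norm (partial_k k j f z) = 1"
  then have "partial_k k i f z * axis j (1 / partial_k k j f z) $ i = (if i = j then 1 else 0)" for i
    by (auto simp: axis_def)
  then have "Dk_pair k f z (axis j (1 / partial_k k j f z)) = 1"
    by (simp add: Dk_pair_def)
  moreover have "norm (axis j (1 / partial_k k j f z)) = 1"
    using 1 by (simp add: norm_vec_def L2_set_def axis_def if_distrib[of norm] if_distrib[of "\<lambda>x. x ^ 2"] norm_divide cong: if_cong)
  ultimately show False using assms by blast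
qed

theorem theorem6:
  fixes D :: "(complex ^ 'n) set"
    and F :: "(complex ^ 'n \<Rightarrow> complex) set"
    and k :: nat
  assumes "open D" and "connected D" and "D \<noteq> {}"
    and "\<forall>f\<in>F. holomorphic_on_n f D"
    and "k \<ge> 1"
    and "\<forall>f\<in>F. \<forall>z\<in>D. f z \<noteq> 0"
    and "\<forall>f\<in>F. \<forall>z\<in>D. \<forall>v. norm v = 1 \<longrightarrow> Dk_pair k f z v \<noteq> 1"
  shows "normal_family_on F D"
proof -
  have "F \<subseteq> avoiding k D"
  proof
    fix f assume f: "f \<in> F"
    have "norm (partial_k k j f z) \<noteq> 1" if "z \<in> D" for z j
      by (rule partial_k_norm_neq_1) (use assms(7) f that in simp)
    then show "f \<in> avoiding k D"
      using assms(4,6) f by (simp add: avoiding_def)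
  qed
  then show ?thesis
    by (rule normal_family_on_subset[OF avoiding_normal[OF assms(1,2,3,5)]])
qed

end
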